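(* Let $N$ be a finite set with $|N|\geq 2$. The polyhedron of vectors $u\in\mathbb{R}^{\mathcal{P}(N)}$ given by the constraints (a) $\sum_{T\subseteq N}u(T)=0$ and $\sum_{T\subseteq N,\,j\in T}u(T)=0$ for every $j\in N$; (b) $\sum_{T\in\mathcal{A}}u(T)\leq 1$ for every non-empty class $\mathcal{A}$ of non-empty subsets of $N$ which is closed under supersets; (c) $\sum_{T\subseteq N}m(T)\,u(T)\geq 0$ for every $m\in\mathcal{M}(N)$; is an LP relaxation of the standard imset polytope over $N$.
   Context: $\mathcal{P}(N)$ is the power set of $N$. A class $\mathcal{A}$ of subsets of $N$ is closed under supersets if $S\in\mathcal{A}$, $S\subseteq T\subseteq N$ implies $T\in\mathcal{A}$. A function $m:\mathcal{P}(N)\to\mathbb{R}$ is supermodular if $m(E\cup F)+m(E\cap F)\geq m(E)+m(F)$ for all $E,F\subseteq N$; it is standardized if $m(T)=0$ whenever $|T|\leq 1$. The standardized supermodular functions form a pointed rational polyhedral cone in $\mathbb{R}^{\mathcal{P}(N)}$. Each extreme ray of this cone contains a unique non-zero lattice point whose components have no common prime divisor; $\mathcal{M}(N)$ denotes the finite set of these representatives of the extreme rays. A directed graph over $N$ has node set $N$ and a collection of arrows $j\to i$ with $i,j\in N$, $i\neq j$; $\mathrm{pa}_G(i)=\{j\in N;\ j\to i\text{ in }G\}$. It is acyclic if it has no directed cycle (sequence $i_1,\ldots,i_n$, $n\geq 3$, with $i_r\to i_{r+1}$ for $r=1,\ldots,n-1$ and $i_n=i_1$). For $A\subseteq N$,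 $\delta_A\in\mathbb{R}^{\mathcal{P}(N)}$ is the vector with $\delta_A(A)=1$ and $\delta_A(S)=0$ for $S\neq A$. For an acyclic directed graph $G$ over $N$ the standard imset is $$u_G=\delta_N-\delta_{\emptyset}+\sum_{i\in N}\left[\delta_{\mathrm{pa}_G(i)}-\delta_{\{i\}\cup\mathrm{pa}_G(i)}\right].$$ The standard imset polytope is the convex hull in $\mathbb{R}^{\mathcal{P}(N)}$ of the set of all $u_G$, where $G$ runs over all acyclic directed graphs over $N$. An LP relaxation of a polytope is an outer polyhedral approximation of it (a polyhedron containing the polytope) such that the only lattice points (vectors with integer components) in the polyhedron are the lattice points in the polytope. *)

theory Defs
  imports "HOL-Analysis.Analysis" "HOL-Computational_Algebra.Primes"
begin

text \<open>
  The ground set \<open>N\<close> is the universe of a finite type \<open>'n\<close>, so the space of real vectors indexed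
  by the subsets of \<open>N\<close> is the Euclidean space \<open>real ^ ('n set)\<close>.
\<close>

definition lattice_point :: "real ^ 'i \<Rightarrow> bool"
  where "lattice_point u \<longleftrightarrow> (\<forall>T. u $ T \<in> \<int>)"

definition supermodular :: "real ^ ('n::finite set) \<Rightarrow> bool"
  where "supermodular m \<longleftrightarrow> (\<forall>E F. m $ (E \<union> F) + m $ (E \<inter> F) \<ge> m $ E + m $ F)"

definition standardized :: "real ^ ('n::finite set) \<Rightarrow> bool"
  where "standardized m \<longleftrightarrow> (\<forall>T. card T \<le> 1 \<longrightarrow> m $ T = 0)"

definition standardized_supermodular_cone :: "(real ^ ('n::finite set)) set"
  where "standardized_supermodular_cone = {m. supermodular m \<and> standardized m}"

definition extreme_ray :: "'a::real_vector set \<Rightarrow> 'a set \<Rightarrow> bool"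
  where "extreme_ray K R \<longleftrightarrow> R face_of K \<and> (\<exists>x. x \<noteq> 0 \<and> R = {c *\<^sub>R x | c. c \<ge> 0})"

definition has_common_prime_divisor :: "real ^ 'i \<Rightarrow> bool"
  where "has_common_prime_divisor u \<longleftrightarrow>
    (\<exists>p::nat. prime p \<and> (\<forall>T. \<exists>k::int. u $ T = of_nat p * of_int k))"

definition extreme_supermodular :: "(real ^ ('n::finite set)) set"
  where "extreme_supermodular =
    {m. (\<exists>R. extreme_ray standardized_supermodular_cone R \<and> m \<in> R) \<and>
        m \<noteq> 0 \<and> lattice_point m \<and> \<not> has_common_prime_divisor m}"

definition superset_closed :: "'n set set \<Rightarrow> bool"
  where "superset_closed \<A> \<longleftrightarrow> (\<forall>S T. S \<in> \<A> \<longrightarrow> S \<subseteq> T \<longrightarrow> T \<in> \<A>)"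

text \<open>
  A directed graph is its set of arrows, \<open>(j, i)\<close> standing for \<open>j \<rightarrow> i\<close>. In the absence of loops
  a closed walk has at least two arrows, so \<^const>\<open>acyclic\<close> excludes exactly the directed cycles
  \<open>i\<^sub>1 \<rightarrow> \<dots> \<rightarrow> i\<^sub>n = i\<^sub>1\<close> with \<open>n \<ge> 3\<close>.
\<close>

definition acyclic_digraph :: "('n \<times> 'n) set \<Rightarrow> bool"
  where "acyclic_digraph G \<longleftrightarrow> irrefl G \<and> acyclic G"

definition parents :: "('n \<times> 'n) set \<Rightarrow> 'n \<Rightarrow> 'n set"
  where "parents G i = {j. (j, i) \<in> G}"

definition delta :: "'n::finite set \<Rightarrow> real ^ ('n set)"
  where "delta A = axis A 1"

definition standard_imset :: "('n::finite \<times> 'n) set \<Rightarrow> real ^ ('n set)"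
  where "standard_imset G =
    delta UNIV - delta {} + (\<Sum>i\<in>UNIV. delta (parents G i) - delta ({i} \<union> parents G i))"

definition standard_imset_polytope :: "(real ^ ('n::finite set)) set"
  where "standard_imset_polytope = convex hull {standard_imset G | G. acyclic_digraph G}"

definition LP_relaxation :: "(real ^ 'i) set \<Rightarrow> (real ^ 'i) set \<Rightarrow> bool"
  where "LP_relaxation Q P \<longleftrightarrow>
    polyhedron Q \<and> P \<subseteq> Q \<and> {u \<in> Q. lattice_point u} = {u \<in> P. lattice_point u}"

end

theory Submission
  imports Defs
begin

text \<open>
  Pairing a set function \<open>f\<close> with \<open>u\<^sub>G\<close> gives
  \<open>f N - f \<emptyset> - (\<Sum>i. f ({i} \<union> pa i) - f (pa i))\<close>: the imset records how far the increments of \<open>f\<close>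
  along the arrows \<open>pa i \<rightarrow> {i} \<union> pa i\<close> of the subset lattice fall short of the total increment.
  All three groups of constraints are read off from this formula.

  The standard imsets satisfy them. The indicator of a superset-closed class has nonnegative
  increments, which gives the upper bounds, and the indicator of \<open>{T. j \<in> T}\<close> increases exactly once,
  at \<open>i = j\<close>. For supermodular \<open>f\<close> and acyclic \<open>G\<close>, the increment at \<open>pa i\<close> is at most the increment
  at the larger set of all predecessors of \<open>i\<close> in a topological order, and the latter increments
  telescope (\<open>sum_parent_increments_le\<close>).

  Conversely, let \<open>u\<close> be a lattice point satisfying the constraints, and put
  \<open>v = \<delta>\<^sub>N - \<delta>\<^sub>\<emptyset> - u\<close>. Then \<open>v\<close> has total mass zero, is nonnegative on superset-closed classes, and
  has mass one on every \<open>{T. j \<in> T}\<close>. So \<open>v\<close> is the divergence of an integral flow on the cube of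
  subsets that climbs each coordinate direction exactly once, that is,
  \<open>v = (\<Sum>i. \<delta>\<^bsub>{i} \<union> pa i\<^esub> - \<delta>\<^bsub>pa i\<^esub>)\<close> for some sets \<open>pa i\<close> with \<open>i \<notin> pa i\<close>
  (\<open>integral_flow_decomposition\<close>). Hence \<open>u = u\<^sub>G\<close> for a loop-free digraph \<open>G\<close>.

  It remains to see that \<open>G\<close> is acyclic. The functions \<open>max 0 (\<bar>T \<inter> C\<bar> - 1)\<close> with \<open>\<bar>C\<bar> \<ge> 2\<close> generate
  extreme rays of the standardized supermodular cone
  (\<open>cluster_function_mem_extreme_supermodular\<close>). If every node of \<open>C\<close> had a parent in \<open>C\<close>, such a
  function would increase \<open>\<bar>C\<bar>\<close> times along \<open>G\<close> although its total increment is \<open>\<bar>C\<bar> - 1\<close>,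
  contradicting the corresponding constraint.

  The relaxation is a polyhedron because the cone is polyhedral: it has finitely many faces, hence
  finitely many extreme rays, and each ray contains at most one primitive lattice point
  (\<open>finite_extreme_supermodular\<close>).
\<close>

section \<open>Pairing set functions with standard imsets\<close>

lemma sum_mult_delta:
  "(\<Sum>T\<in>UNIV. f T * delta A $ T) = f A"
proof -
  have "(\<Sum>T\<in>UNIV. f T * delta A $ T) = (\<Sum>T\<in>UNIV. if T = A then f T else 0)"
    by (rule sum.cong) (auto simp: delta_def axis_def)
  then show ?thesis by simp
qed

lemma sum_mult_standard_imset:
  "(\<Sum>T\<in>UNIV. f T * standard_imset G $ T) =
     f UNIV - f {} - (\<Sum>i\<in>UNIV. f (insert i (parents G i)) - f (parents G i))"
proof -
  have "(\<Sum>T\<in>UNIV. f T * standard_imset G $ T) =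
      (\<Sum>T\<in>UNIV. f T * delta UNIV $ T) - (\<Sum>T\<in>UNIV. f T * delta {} $ T) +
      (\<Sum>i\<in>UNIV. (\<Sum>T\<in>UNIV. f T * delta (parents G i) $ T) -
                  (\<Sum>T\<in>UNIV. f T * delta ({i} \<union> parents G i) $ T))"
    unfolding standard_imset_def
    by (simp add: algebra_simps sum.distrib sum_subtractf sum_distrib_left
          sum.swap[of _ "UNIV :: 'a set set" UNIV])
  then show ?thesis
    by (simp add: sum_mult_delta sum_subtractf)
qed

lemma sum_standard_imset:
  "(\<Sum>T\<in>A. standard_imset G $ T) =
     of_bool (UNIV \<in> A) - of_bool ({} \<in> A) -
     (\<Sum>i\<in>UNIV. of_bool (insert i (parents G i) \<in> A) - of_bool (parents G i \<in> A))"
  using sum_mult_standard_imset[of "\<lambda>T. of_bool (T \<in> A)" G] by (simp del: insert_iff)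

section \<open>Standard imsets satisfy the constraints\<close>

lemma acyclic_digraph_self_notin_parents:
  "acyclic_digraph G \<Longrightarrow> i \<notin> parents G i"
  by (auto simp: acyclic_digraph_def parents_def irrefl_def)

lemma sum_standard_imset_UNIV:
  "(\<Sum>T\<in>UNIV. standard_imset G $ T) = 0"
  by (simp add: sum_standard_imset)

lemma sum_standard_imset_containing:
  assumes "acyclic_digraph G"
  shows "(\<Sum>T | j \<in> T. standard_imset G $ T) = 0"
proof -
  have "(\<Sum>i\<in>UNIV. of_bool (insert i (parents G i) \<in> {T. j \<in> T}) - of_bool (parents G i \<in> {T. j \<in> T}))
      = (\<Sum>i\<in>UNIV. if i = j then 1 else (0::real))"
    by (rule sum.cong) (use acyclic_digraph_self_notin_parents[OF assms] in auto)
  then show ?thesis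
    by (simp add: sum_standard_imset del: insert_iff)
qed

lemma sum_standard_imset_superset_closed_le:
  assumes "superset_closed \<A>"
  shows "(\<Sum>T\<in>\<A>. standard_imset G $ T) \<le> 1"
proof -
  have "0 \<le> (\<Sum>i\<in>UNIV. of_bool (insert i (parents G i) \<in> \<A>) - of_bool (parents G i \<in> \<A>) :: real)"
  proof (rule sum_nonneg)
    fix i
    have "insert i (parents G i) \<in> \<A>" if "parents G i \<in> \<A>"
      using assms that unfolding superset_closed_def by blast
    then show "0 \<le> (of_bool (insert i (parents G i) \<in> \<A>) - of_bool (parents G i \<in> \<A>) :: real)"
      by auto
  qed
  moreover have "of_bool (UNIV \<in> \<A>) \<le> (1::real)" "0 \<le> (of_bool ({} \<in> \<A>) :: real)"
    by auto
  ultimately show ?thesis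
    unfolding sum_standard_imset by linarith
qed

text \<open>
  Stated for ancestral sets \<open>A\<close>, so that a node of \<open>A\<close> without children in \<open>A\<close> can be removed.
  Supermodularity bounds its increment at its parents by its increment at the rest of \<open>A\<close>.
\<close>

lemma sum_parent_increments_le:
  fixes m :: "real ^ ('n::finite set)"
  assumes m: "supermodular m" and G: "acyclic G"
  shows "\<forall>i\<in>A. parents G i \<subseteq> A \<Longrightarrow>
    (\<Sum>i\<in>A. m $ (insert i (parents G i)) - m $ (parents G i)) \<le> m $ A - m $ {}"
proof (induction "card A" arbitrary: A)
  case 0
  then show ?case by simp
next
  case (Suc k)
  then have "A \<noteq> {}" by auto
  moreover have "wf (G\<inverse>)"
    using G finite_acyclic_wf_converse[of G] by simp
  ultimately obtain i where i: "i \<in> A" and sink: "\<And>j. (i, j) \<in> G \<Longrightarrow> j \<notin> A"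
    by (metis wfE_min ex_in_conv converse_iff)
  let ?B = "A - {i}"
  have "\<forall>j\<in>?B. parents G j \<subseteq> ?B"
    using Suc.prems sink by (auto simp: parents_def)
  moreover have "k = card ?B"
    using Suc.hyps(2) i by simp
  ultimately have IH: "(\<Sum>j\<in>?B. m $ (insert j (parents G j)) - m $ (parents G j)) \<le> m $ ?B - m $ {}"
    using Suc.hyps(1) by blast
  have "i \<notin> parents G i"
    using sink i by (auto simp: parents_def)
  then have "insert i (parents G i) \<union> ?B = A" "insert i (parents G i) \<inter> ?B = parents G i"
    using i Suc.prems by auto
  then have "m $ (insert i (parents G i)) - m $ (parents G i) \<le> m $ A - m $ ?B"
    using m[unfolded supermodular_def, rule_format, of "insert i (parents G i)" ?B] by simp
  with IH show ?case
    using i by (simp add: sum.remove[of A i])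
qed

lemma sum_supermodular_mult_standard_imset_nonneg:
  assumes "supermodular m" "acyclic G"
  shows "0 \<le> (\<Sum>T\<in>UNIV. m $ T * standard_imset G $ T)"
  using sum_parent_increments_le[OF assms, of UNIV] by (simp add: sum_mult_standard_imset)

section \<open>Finitely many extreme supermodular functions\<close>

lemma polyhedron_sum_mult_ge:
  fixes f :: "('n::finite) set \<Rightarrow> real"
  shows "polyhedron {u. (\<Sum>T\<in>UNIV. f T * u $ T) \<ge> b}"
proof -
  have "{u. (\<Sum>T\<in>UNIV. f T * u $ T) \<ge> b} = {u. (\<chi> T. f T) \<bullet> u \<ge> b}"
    by (simp add: inner_vec_def)
  then show ?thesis by (simp add: polyhedron_halfspace_ge)
qed

lemma polyhedron_sum_le:
  "polyhedron {u :: real ^ ('n::finite set). (\<Sum>T\<in>A. u $ T) \<le> b}"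
proof -
  have "{u. (\<Sum>T\<in>A. u $ T) \<le> b} = {u. (\<Sum>T\<in>UNIV. - of_bool (T \<in> A) * u $ T) \<ge> - b}"
    by (simp add: sum_negf)
  then show ?thesis by (simp only: polyhedron_sum_mult_ge)
qed

lemma polyhedron_sum_eq:
  "polyhedron {u :: real ^ ('n::finite set). (\<Sum>T\<in>A. u $ T) = b}"
proof -
  have "{u. (\<Sum>T\<in>A. u $ T) = b} =
      {u. (\<Sum>T\<in>A. u $ T) \<le> b} \<inter> {u. (\<Sum>T\<in>UNIV. of_bool (T \<in> A) * u $ T) \<ge> b}"
    by auto
  then show ?thesis
    by (simp only: polyhedron_Int polyhedron_sum_mult_ge polyhedron_sum_le)
qed

lemma polyhedron_standardized_supermodular_cone:
  "polyhedron (standardized_supermodular_cone :: (real ^ ('n::finite set)) set)"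
proof -
  let ?super = "\<lambda>(E, F). {m :: real ^ ('n set). m $ (E \<union> F) + m $ (E \<inter> F) \<ge> m $ E + m $ F}"
  let ?std = "\<lambda>T. {m :: real ^ ('n set). m $ T = 0}"
  have super: "polyhedron (?super p)" for p
  proof (cases p)
    case (Pair E F)
    have "?super p = {m. (axis (E \<union> F) 1 + axis (E \<inter> F) 1 - axis E 1 - axis F 1) \<bullet> m \<ge> 0}"
      by (auto simp: Pair inner_diff_left inner_add_left inner_axis')
    then show ?thesis by (simp only: polyhedron_halfspace_ge)
  qed
  have std: "polyhedron (?std T)" for T
    using polyhedron_sum_eq[of "{T}" 0] by simp
  have eq: "standardized_supermodular_cone =
      (\<Inter>p\<in>UNIV. ?super p) \<inter> (\<Inter>T\<in>{T. card T \<le> 1}. ?std T)"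
    by (auto simp: standardized_supermodular_cone_def supermodular_def standardized_def)
  show ?thesis
    unfolding eq
  proof (intro polyhedron_Int polyhedron_Inter ballI)
    fix S assume "S \<in> range ?super"
    then obtain p where "S = ?super p" by (rule rangeE)
    then show "polyhedron S" using super[of p] by (simp only:)
  next
    fix S assume "S \<in> ?std ` {T. card T \<le> 1}"
    then obtain T where "S = ?std T" by (rule imageE)
    then show "polyhedron S" using std[of T] by (simp only:)
  qed auto
qed

text \<open>
  If the primitive vector \<open>x\<close> is scaled by the reduced fraction \<open>a / b\<close> into a lattice point, then
  \<open>b\<close> divides every component of \<open>x\<close>.
\<close>

lemma multiplier_eq_1_if_no_common_prime_divisor:
  assumes x: "lattice_point x" "\<not> has_common_prime_divisor x"
    and y: "lattice_point y" and ab: "coprime a b"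
    and eq: "\<And>T. real b * y $ T = real a * x $ T"
  shows "b = 1"
proof (rule ccontr)
  assume "b \<noteq> 1"
  then obtain p where p: "prime p" "p dvd b"
    using prime_factor_nat by blast
  have "\<exists>k::int. x $ T = of_nat p * of_int k" for T
  proof -
    obtain k l where k: "x $ T = of_int k" and l: "y $ T = of_int l"
      using x(1) y unfolding lattice_point_def by (meson Ints_cases)
    have "int b * l = int a * k"
      using eq[of T] unfolding k l by (metis of_int_eq_iff of_int_mult of_int_of_nat_eq)
    then have "int b dvd int a * k" by (metis dvd_triv_left)
    then have "int b dvd k"
      using ab by (simp add: coprime_dvd_mult_right_iff coprime_commute)
    with p(2) have "int p dvd k"
      by (meson dvd_trans int_dvd_int_iff)
    then show ?thesis
      unfolding k by (auto elim!: dvdE)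
  qed
  with p(1) x(2) show False
    unfolding has_common_prime_divisor_def by blast
qed

lemma primitive_lattice_point_on_ray_unique:
  fixes x y :: "real ^ 'i::finite"
  assumes x: "x \<noteq> 0" "lattice_point x" "\<not> has_common_prime_divisor x"
    and y: "lattice_point y" "\<not> has_common_prime_divisor y"
    and q: "y = q *\<^sub>R x" "q > 0"
  shows "x = y"
proof -
  obtain T where T: "x $ T \<noteq> 0"
    using x(1) by (auto simp: vec_eq_iff)
  have "q = y $ T / x $ T"
    using q(1) T by simp
  moreover have "x $ T \<in> \<rat>" "y $ T \<in> \<rat>"
    using x(2) y(1) unfolding lattice_point_def by (auto elim!: allE[of _ T] Ints_cases)
  ultimately have "q \<in> \<rat>"
    by (simp only: Rats_divide)
  then obtain a b where ab: "b \<noteq> 0" "\<bar>q\<bar> = real a / real b" "coprime a b"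
    by (rule Rats_abs_nat_div_natE)
  have eq: "real b * y $ T = real a * x $ T" for T
    using ab q by (simp add: field_simps)
  have "b = 1"
    using multiplier_eq_1_if_no_common_prime_divisor[OF x(2,3) y(1) ab(3) eq] .
  moreover have "a = 1"
    by (rule multiplier_eq_1_if_no_common_prime_divisor[OF y x(2), of b])
       (use ab eq in \<open>auto simp: coprime_commute\<close>)
  ultimately show ?thesis
    using ab(2) q by simp
qed

lemma finite_extreme_supermodular:
  "finite (extreme_supermodular :: (real ^ ('n::finite set)) set)"
proof -
  let ?K = "standardized_supermodular_cone :: (real ^ ('n::finite set)) set"
  let ?P = "\<lambda>m. m \<noteq> 0 \<and> lattice_point m \<and> \<not> has_common_prime_divisor m"
  have rays: "finite {R. extreme_ray ?K R}"
    by (rule finite_subset[OF _ finite_polyhedron_faces[OF polyhedron_standardized_supermodular_cone]])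
       (auto simp: extreme_ray_def)
  have points: "finite {m \<in> R. ?P m}" if R: "extreme_ray ?K R" for R
  proof -
    have "m = m'" if m: "m \<in> R" "?P m" and m': "m' \<in> R" "?P m'" for m m'
    proof -
      obtain x c c' where x: "m = c *\<^sub>R x" "m' = c' *\<^sub>R x" "c \<ge> 0" "c' \<ge> 0"
        using R m(1) m'(1) unfolding extreme_ray_def by auto
      then have "c > 0" "c' > 0"
        using m m' by (auto simp: less_le)
      then have "m' = (c' / c) *\<^sub>R m" "c' / c > 0"
        using x by auto
      then show ?thesis
        using primitive_lattice_point_on_ray_unique m m' by blast
    qed
    then have "\<exists>x. {m \<in> R. ?P m} \<subseteq> {x}"
      by blast
    then show ?thesis
      using finite_subset by blast
  qed
  have "extreme_supermodular = (\<Union>R\<in>{R. extreme_ray ?K R}. {m \<in> R. ?P m})"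
    by (auto simp: extreme_supermodular_def)
  also have "finite \<dots>"
    by (rule finite_UN_I) (use rays points in auto)
  finally show ?thesis .
qed

section \<open>The extreme supermodular functions that detect cycles\<close>

text \<open>
  The subtraction on natural numbers truncates, so the value is \<open>max 0 (\<bar>T \<inter> C\<bar> - 1)\<close>.
\<close>

definition cluster_function :: "'n set \<Rightarrow> real ^ ('n::finite set)"
  where "cluster_function C = (\<chi> T. real (card (T \<inter> C) - 1))"

lemma cluster_function_mem_cone:
  "cluster_function C \<in> standardized_supermodular_cone"
proof -
  have super: "cluster_function C $ (E \<union> F) + cluster_function C $ (E \<inter> F)
      \<ge> cluster_function C $ E + cluster_function C $ F" for E F :: "'a set"
  proof -
    let ?e = "E \<inter> C" and ?f = "F \<inter> C"
    have "card ?e + card ?f = card (?e \<union> ?f) + card (?e \<inter> ?f)"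
      by (rule card_Un_Int) auto
    moreover have "(E \<union> F) \<inter> C = ?e \<union> ?f" "(E \<inter> F) \<inter> C = ?e \<inter> ?f"
      by auto
    moreover have "card ?e \<le> card (?e \<union> ?f)" "card ?f \<le> card (?e \<union> ?f)"
      by (auto intro: card_mono)
    moreover have "(a - 1) + (b - 1) \<le> (c - 1) + (d - 1)"
      if "a + b = c + d" "a \<le> c" "b \<le> c" for a b c d :: nat
      using that by arith
    ultimately have "(card ?e - 1) + (card ?f - 1) \<le>
        (card ((E \<union> F) \<inter> C) - 1) + (card ((E \<inter> F) \<inter> C) - 1)"
      by (simp only:)
    then have "real (card ?e - 1) + real (card ?f - 1) \<le>
        real (card ((E \<union> F) \<inter> C) - 1) + real (card ((E \<inter> F) \<inter> C) - 1)"
      unfolding of_nat_add[symmetric] by (rule of_nat_mono)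
    then show ?thesis
      unfolding cluster_function_def vec_lambda_beta .
  qed
  have std: "cluster_function C $ T = 0" if "card T \<le> 1" for T
  proof -
    have "card (T \<inter> C) \<le> card T" by (rule card_mono) auto
    with that show ?thesis by (simp add: cluster_function_def)
  qed
  show ?thesis
    unfolding standardized_supermodular_cone_def supermodular_def standardized_def
    using super std by blast
qed

lemma supermodular_increment_mono:
  assumes "supermodular m" "S \<subseteq> T" "i \<notin> T"
  shows "m $ (insert i S) - m $ S \<le> m $ (insert i T) - m $ T"
proof -
  have "insert i S \<union> T = insert i T" "insert i S \<inter> T = S"
    using assms by auto
  then show ?thesis
    using assms(1)[unfolded supermodular_def, rule_format, of "insert i S" T] by simp
qed

lemma cluster_function_increment:
  assumes "i \<notin> T"
  shows "cluster_function C $ (insert i T) - cluster_function C $ T =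
    of_bool (i \<in> C \<and> T \<inter> C \<noteq> {})"
proof (cases "i \<in> C")
  case True
  then have "insert i T \<inter> C = insert i (T \<inter> C)" "i \<notin> T \<inter> C"
    using assms by auto
  moreover have "T \<inter> C \<noteq> {} \<Longrightarrow> card (T \<inter> C) \<ge> 1"
    by (simp add: Suc_le_eq card_gt_0_iff)
  ultimately show ?thesis
    using True by (auto simp: cluster_function_def of_nat_diff)
next
  case False
  then show ?thesis by (simp add: cluster_function_def)
qed

text \<open>
  Increments of a supermodular function grow with the set. Where the sum \<open>a + b\<close> has constant
  increments, those of \<open>a\<close> and of \<open>b\<close> must therefore be constant too. So the increment of \<open>a\<close> by
  \<open>i \<in> C\<close> takes the same value \<open>a {i, j}\<close> at all sets containing \<open>j \<in> C\<close>; comparing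
  \<open>{j}\<close> and \<open>{k}\<close> with \<open>{j, k}\<close> shows that this value does not depend on the pair. All other
  increments vanish as they do at the empty set.
\<close>

lemma cone_summand_of_cluster_function:
  fixes a b :: "real ^ ('n::finite set)"
  assumes a: "a \<in> standardized_supermodular_cone" and b: "b \<in> standardized_supermodular_cone"
    and sum: "a + b = c *\<^sub>R cluster_function C"
    and pq: "p \<in> C" "q \<in> C" "p \<noteq> q"
  shows "a = a $ {p, q} *\<^sub>R cluster_function C"
proof -
  let ?d = "\<lambda>f :: real ^ ('n set). \<lambda>i T. f $ (insert i T) - f $ T"
  note sm = a[unfolded standardized_supermodular_cone_def] b[unfolded standardized_supermodular_cone_def]
  have zero: "f $ T = 0" if "card T \<le> 1" "f \<in> {a, b}" for f T
    using sm that by (auto simp: standardized_def)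
  have incr: "?d a i T + ?d b i T = c * of_bool (i \<in> C \<and> T \<inter> C \<noteq> {})" if "i \<notin> T" for i T
  proof -
    have "?d a i T + ?d b i T = ?d (a + b) i T" by simp
    also have "\<dots> = c * (cluster_function C $ (insert i T) - cluster_function C $ T)"
      unfolding sum by (simp add: algebra_simps)
    finally show ?thesis using cluster_function_increment[OF that] by simp
  qed
  have tight: "?d a i S = ?d a i T"
    if "S \<subseteq> T" "i \<notin> T" "i \<in> C \<and> T \<inter> C \<noteq> {} \<longleftrightarrow> i \<in> C \<and> S \<inter> C \<noteq> {}" for i S T
  proof -
    have "?d a i S \<le> ?d a i T" "?d b i S \<le> ?d b i T"
      using sm that by (auto intro!: supermodular_increment_mono)
    moreover have "i \<notin> S" using that by auto
    ultimately show ?thesis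
      using incr[of i S] incr[OF that(2)] that(3) by simp
  qed
  have incr_pair: "?d a i T = a $ {i, j}" if "i \<notin> T" "i \<in> C" "j \<in> T" "j \<in> C" for i j T
  proof -
    have "?d a i {j} = ?d a i T"
      by (rule tight) (use that in auto)
    then show ?thesis using zero[of "{j}" a] by simp
  qed
  \<comment> \<open>Both sides are the increment of \<open>a\<close> by \<open>i\<close> at \<open>{j, k}\<close>.\<close>
  have share: "a $ {i, j} = a $ {i, k}" if "i \<in> C" "j \<in> C" "k \<in> C" "j \<noteq> i" "k \<noteq> i" for i j k
    using incr_pair[of i "{j, k}" j] incr_pair[of i "{j, k}" k] that by auto
  have pair: "a $ {i, j} = a $ {p, q}" if "i \<in> C" "j \<in> C" "i \<noteq> j" for i j
  proof (cases "i = p")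
    case True
    then show ?thesis using share[of p j q] pq that by auto
  next
    case False
    then have "a $ {i, j} = a $ {i, p}" using share[of i j p] pq that by auto
    also have "\<dots> = a $ {p, q}"
      using share[of p i q] pq that False by (simp add: insert_commute)
    finally show ?thesis .
  qed
  have "a $ T = a $ {p, q} * cluster_function C $ T" for T
  proof (induction T rule: finite_induct[OF finite])
    case 1
    then show ?case using zero[of "{}" a] by (simp add: cluster_function_def)
  next
    case (2 i T)
    have "?d a i T = a $ {p, q} * of_bool (i \<in> C \<and> T \<inter> C \<noteq> {})"
    proof (cases "i \<in> C \<and> T \<inter> C \<noteq> {}")
      case True
      then obtain j where "j \<in> T" "j \<in> C" by auto
      then show ?thesis
        using incr_pair[of i T j] pair[of i j] 2 True by auto
    next
      case False
      then show ?thesis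
        using tight[of "{}" T i] 2 zero[of "{}" a] zero[of "{i}" a] by auto
    qed
    then show ?case
      using 2 cluster_function_increment[of i T C] by (simp add: algebra_simps)
  qed
  then show ?thesis
    unfolding vec_eq_iff vector_scaleR_component real_scaleR_def by blast
qed

lemma scaleR_mem_standardized_supermodular_cone:
  assumes m: "m \<in> standardized_supermodular_cone" and "c \<ge> 0"
  shows "c *\<^sub>R m \<in> standardized_supermodular_cone"
proof -
  have "c * (m $ E + m $ F) \<le> c * (m $ (E \<union> F) + m $ (E \<inter> F))" for E F
    using assms
    by (intro mult_left_mono) (auto simp: standardized_supermodular_cone_def supermodular_def)
  with m show ?thesis
    by (simp add: standardized_supermodular_cone_def supermodular_def standardized_def distrib_left)
qed

lemma standardized_supermodular_pair_nonneg:
  assumes "m \<in> standardized_supermodular_cone"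
  shows "m $ {p, q} \<ge> 0"
proof (cases "p = q")
  case False
  then show ?thesis
    using assms supermodular_increment_mono[of m "{}" "{q}" p]
    by (auto simp: standardized_supermodular_cone_def standardized_def)
qed (use assms in \<open>auto simp: standardized_supermodular_cone_def standardized_def\<close>)

lemma cluster_function_mem_extreme_supermodular:
  fixes C :: "'n::finite set"
  assumes "card C \<ge> 2"
  shows "cluster_function C \<in> extreme_supermodular"
proof -
  let ?K = "standardized_supermodular_cone :: (real ^ ('n set)) set" and ?m = "cluster_function C"
  let ?R = "{c *\<^sub>R ?m | c. c \<ge> 0}"
  obtain p q where pq: "p \<in> C" "q \<in> C" "p \<noteq> q"
    using assms by (metis card_le_Suc0_iff_eq finite not_less_eq_eq numeral_2_eq_2)
  have val: "?m $ {p, q} = 1"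
    using cluster_function_increment[of p "{q}" C] pq by (auto simp: cluster_function_def)
  then have nz: "?m \<noteq> 0" by auto
  have "?R face_of ?K"
    unfolding face_of_def
  proof (intro conjI ballI impI)
    show "?R \<subseteq> ?K"
      using scaleR_mem_standardized_supermodular_cone cluster_function_mem_cone by blast
    have "?R = (\<lambda>c. c *\<^sub>R ?m) ` {0..}" by auto
    then show "convex ?R"
      using convex_linear_image[OF bounded_linear.linear[OF bounded_linear_scaleR_left],
          OF convex_real_interval(1)]
      by simp
  next
    fix a b x assume a: "a \<in> ?K" and b: "b \<in> ?K" and x: "x \<in> ?R" "x \<in> open_segment a b"
    obtain c t where c: "x = c *\<^sub>R ?m" and t: "0 < t" "t < 1" "x = (1 - t) *\<^sub>R a + t *\<^sub>R b"
      using x unfolding in_segment by blast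
    let ?a = "(1 - t) *\<^sub>R a" and ?b = "t *\<^sub>R b"
    have ab: "?a \<in> ?K" "?b \<in> ?K"
      using scaleR_mem_standardized_supermodular_cone[OF a, of "1 - t"]
        scaleR_mem_standardized_supermodular_cone[OF b, of t] t by simp_all
    have eq: "?a + ?b = c *\<^sub>R ?m" "?b + ?a = c *\<^sub>R ?m"
      using c t(3) by (auto simp: add.commute)
    have "?a = ?a $ {p, q} *\<^sub>R ?m" "?b = ?b $ {p, q} *\<^sub>R ?m"
      using cone_summand_of_cluster_function[OF ab eq(1) pq]
        cone_summand_of_cluster_function[OF ab(2) ab(1) eq(2) pq] .
    then have "(1 - t) *\<^sub>R a = (1 - t) *\<^sub>R (a $ {p, q} *\<^sub>R ?m)" "t *\<^sub>R b = t *\<^sub>R (b $ {p, q} *\<^sub>R ?m)"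
      by simp_all
    then have "a = a $ {p, q} *\<^sub>R ?m" "b = b $ {p, q} *\<^sub>R ?m"
      using t unfolding scaleR_cancel_left by simp_all
    then show "a \<in> ?R" "b \<in> ?R"
      using standardized_supermodular_pair_nonneg[OF a, of p q]
        standardized_supermodular_pair_nonneg[OF b, of p q] by blast+
  qed
  then have "extreme_ray ?K ?R"
    using nz by (auto simp: extreme_ray_def)
  moreover have "?m \<in> ?R"
    by (auto intro!: exI[of _ 1])
  moreover have "lattice_point ?m"
    by (auto simp: lattice_point_def cluster_function_def)
  moreover have "\<not> has_common_prime_divisor ?m"
  proof
    assume "has_common_prime_divisor ?m"
    then obtain r k where r: "prime (r::nat)" "?m $ {p, q} = of_nat r * of_int k"
      unfolding has_common_prime_divisor_def by blast
    then have "int r * k = 1"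
      using val by (metis of_int_1 of_int_eq_iff of_int_mult of_int_of_nat_eq)
    then show False
      using r(1) by (metis dvd_triv_left int_dvd_int_iff not_prime_unit of_nat_1)
  qed
  ultimately show ?thesis
    using nz by (auto simp: extreme_supermodular_def)
qed

text \<open>
  On a cycle through \<open>x\<close>, the strongly connected component of \<open>x\<close> contains a parent of each of
  its members.
\<close>

lemma acyclic_if_no_parent_closed_set:
  assumes "\<And>C. C \<noteq> {} \<Longrightarrow> \<exists>i\<in>C. parents G i \<inter> C = {}"
  shows "acyclic G"
proof (rule acyclicI, intro allI notI)
  fix x assume x: "(x, x) \<in> G\<^sup>+"
  let ?C = "{y. (x, y) \<in> G\<^sup>* \<and> (y, x) \<in> G\<^sup>*}"
  have "?C \<noteq> {}" by auto
  moreover have "parents G y \<inter> ?C \<noteq> {}" if "y \<in> ?C" for y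
  proof -
    have "(x, y) \<in> G\<^sup>+"
      using that x by (auto dest: rtranclD)
    then obtain z where "(x, z) \<in> G\<^sup>*" "(z, y) \<in> G"
      by (meson tranclD2)
    then show ?thesis
      using that by (auto simp: parents_def intro: converse_rtrancl_into_rtrancl)
  qed
  ultimately show False
    using assms[of ?C] by blast
qed

text \<open>
  A set \<open>C\<close> that contains a parent of each of its members makes all \<open>\<bar>C\<bar>\<close> increments of its cluster function
  equal to one, so its pairing with the imset is \<open>(\<bar>C\<bar> - 1) - \<bar>C\<bar> = -1\<close>.
\<close>

lemma acyclic_if_standard_imset_nonneg:
  fixes G :: "('n::finite \<times> 'n) set"
  assumes irr: "irrefl G"
    and nonneg: "\<And>m. m \<in> extreme_supermodular \<Longrightarrow> 0 \<le> (\<Sum>T\<in>UNIV. m $ T * standard_imset G $ T)"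
  shows "acyclic G"
proof (rule acyclic_if_no_parent_closed_set, rule ccontr)
  fix C :: "'n set"
  assume C: "C \<noteq> {}" and "\<not> (\<exists>i\<in>C. parents G i \<inter> C = {})"
  then have par: "parents G i \<inter> C \<noteq> {}" if "i \<in> C" for i
    using that by auto
  have self: "i \<notin> parents G i" for i
    using irr by (auto simp: parents_def irrefl_def)
  obtain i where i: "i \<in> C" using C by auto
  then obtain j where "j \<in> C" "j \<noteq> i"
    using par self by blast
  then have "card {i, j} \<le> card C" "card {i, j} = 2"
    using i card_mono[of C "{i, j}"] by auto
  then have C2: "card C \<ge> 2" by simp
  let ?m = "cluster_function C"
  have "(\<Sum>i\<in>UNIV. ?m $ (insert i (parents G i)) - ?m $ (parents G i)) =
      (\<Sum>i\<in>UNIV. of_bool (i \<in> C))"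
    by (rule sum.cong) (use cluster_function_increment[OF self] par in auto)
  also have "\<dots> = real (card C)" by simp
  finally have "(\<Sum>T\<in>UNIV. ?m $ T * standard_imset G $ T) = (real (card C) - 1) - card C"
    using C2 by (simp add: sum_mult_standard_imset cluster_function_def of_nat_diff)
  then show False
    using nonneg[OF cluster_function_mem_extreme_supermodular[OF C2]] by simp
qed

section \<open>Integral flows along the arrows of the cube\<close>

text \<open>
  Uncrossing: superset-closed classes are closed under union and intersection and \<open>sum v\<close> is modular
  on them, so the classes where it attains its minimum \<open>0\<close> are closed under union.
\<close>

lemma sum_superset_closed_eq_0_UN:
  fixes v :: "'n::finite set \<Rightarrow> int"
  assumes nonneg: "\<And>\<A>. superset_closed \<A> \<Longrightarrow> 0 \<le> sum v \<A>"
    and "finite I" "\<And>i. i \<in> I \<Longrightarrow> superset_closed (A i)" "\<And>i. i \<in> I \<Longrightarrow> sum v (A i) = 0"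
  shows "sum v (\<Union>i\<in>I. A i) = 0"
  using assms(2-)
proof (induction I rule: finite_induct)
  case empty
  then show ?case by simp
next
  case (insert i I)
  let ?U = "\<Union>i\<in>I. A i"
  have A: "superset_closed (A k)" if "k \<in> insert i I" for k
    using insert.prems(1) that .
  have U: "superset_closed ?U"
    unfolding superset_closed_def
  proof (intro allI impI)
    fix S T assume "S \<in> ?U" "S \<subseteq> T"
    then obtain k where "k \<in> I" "S \<in> A k" by blast
    with \<open>S \<subseteq> T\<close> have "T \<in> A k"
      using A[of k] unfolding superset_closed_def by blast
    with \<open>k \<in> I\<close> show "T \<in> ?U" by blast
  qed
  have "superset_closed (A i \<union> ?U)" "superset_closed (A i \<inter> ?U)"
    using A[OF insertI1] U unfolding superset_closed_def Un_iff Int_iff by meson+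
  then have "0 \<le> sum v (A i \<union> ?U)" "0 \<le> sum v (A i \<inter> ?U)"
    by (simp_all only: nonneg)
  moreover have "sum v (A i \<union> ?U) + sum v (A i \<inter> ?U) = sum v (A i) + sum v ?U"
    by (rule sum.union_inter) auto
  moreover have "sum v ?U = 0" "sum v (A i) = 0"
    using insert by auto
  ultimately have "sum v (A i \<union> ?U) = 0" by linarith
  then show ?case by simp
qed

text \<open>
  Cancelling the arrow from \<open>T\<close> to \<open>insert i T\<close> lowers the mass of exactly those classes that contain
  \<open>insert i T\<close> but not \<open>T\<close>. If each direction \<open>i\<close> were blocked by such a class of mass zero, the
  union of these classes would have mass zero as well and would contain every proper superset of
  \<open>T\<close>; adding \<open>T\<close> to it gives a superset-closed class of mass \<open>v T < 0\<close>.
\<close>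

lemma exists_removable_arrow:
  fixes v :: "'n::finite set \<Rightarrow> int"
  assumes nonneg: "\<And>\<A>. superset_closed \<A> \<Longrightarrow> 0 \<le> sum v \<A>"
    and neg: "v T < 0"
  shows "\<exists>i. i \<notin> T \<and>
    (\<forall>\<A>. superset_closed \<A> \<longrightarrow> insert i T \<in> \<A> \<longrightarrow> T \<notin> \<A> \<longrightarrow> 0 < sum v \<A>)"
proof (rule ccontr)
  assume contra: "\<not> ?thesis"
  have "\<exists>\<A>. superset_closed \<A> \<and> insert i T \<in> \<A> \<and> T \<notin> \<A> \<and> sum v \<A> = 0"
    if i: "i \<notin> T" for i
  proof -
    obtain \<A> where \<A>: "superset_closed \<A>" "insert i T \<in> \<A>" "T \<notin> \<A>" "\<not> 0 < sum v \<A>"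
      using contra i by blast
    then have "sum v \<A> = 0" using nonneg[of \<A>] by linarith
    with \<A> show ?thesis by blast
  qed
  then obtain A where A: "\<And>i. i \<notin> T \<Longrightarrow>
      superset_closed (A i) \<and> insert i T \<in> A i \<and> T \<notin> A i \<and> sum v (A i) = 0"
    by metis
  let ?U = "\<Union>i\<in>-T. A i"
  have "sum v ?U = 0"
    by (rule sum_superset_closed_eq_0_UN[OF nonneg]) (use A in auto)
  moreover have "T \<notin> ?U" using A by auto
  ultimately have "sum v (insert T ?U) = v T" by simp
  moreover have "superset_closed (insert T ?U)"
    unfolding superset_closed_def
  proof (intro allI impI)
    fix S S' assume S: "S \<in> insert T ?U" "S \<subseteq> S'"
    show "S' \<in> insert T ?U"
    proof (cases "S' = T")
      case False
      then consider "S \<in> ?U" | i where "i \<in> S'" "i \<notin> T" "T \<subseteq> S'"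
        using S by blast
      then show ?thesis
      proof cases
        case 1
        then show ?thesis using A S(2) unfolding superset_closed_def by blast
      next
        case (2 i)
        then have "insert i T \<subseteq> S'" by auto
        then show ?thesis using A[OF 2(2)] 2(2) unfolding superset_closed_def by blast
      qed
    qed simp
  qed
  ultimately show False
    using nonneg[of "insert T ?U"] neg by simp
qed

lemma sum_of_bool_singleton:
  fixes A :: "'n::finite set set"
  shows "(\<Sum>S\<in>A. of_bool (S = T)) = (of_bool (T \<in> A) :: int)"
  by (simp add: of_bool_def)

text \<open>
  Arrows are peeled off one at a time, starting from any set of negative mass. Cancelling an arrow in
  direction \<open>i\<close> lowers the mass of \<open>{T. i \<in> T}\<close> from one to zero, so each direction is used
  once and \<open>J\<close> is the set of directions still to be used.
\<close>

lemma integral_flow_decomposition: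
  fixes v :: "'n::finite set \<Rightarrow> int"
  assumes "\<And>\<A>. superset_closed \<A> \<Longrightarrow> 0 \<le> sum v \<A>"
    and "sum v UNIV = 0"
    and "\<And>j. sum v {T. j \<in> T} = of_bool (j \<in> J)"
  shows "\<exists>pa. (\<forall>i\<in>J. i \<notin> pa i) \<and>
    (\<forall>S. v S = (\<Sum>i\<in>J. of_bool (S = insert i (pa i)) - of_bool (S = pa i)))"
  using assms
proof (induction "card J" arbitrary: J v rule: less_induct)
  case less
  note nonneg = less.prems(1)
  show ?case
  proof (cases "\<exists>T. v T < 0")
    case False
    then have v0: "v S = 0" for S
      using less.prems(2) sum_nonneg_eq_0_iff[of UNIV v] by (simp add: not_less)
    have "j \<notin> J" for j
      using less.prems(3)[of j] by (simp add: v0)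
    then have "J = {}" by blast
    then show ?thesis using v0 by simp
  next
    case True
    then obtain T where "v T < 0" by blast
    then obtain i where i: "i \<notin> T"
      and pos: "\<And>\<A>. superset_closed \<A> \<Longrightarrow> insert i T \<in> \<A> \<Longrightarrow> T \<notin> \<A> \<Longrightarrow> 0 < sum v \<A>"
      using exists_removable_arrow[of v T, OF nonneg] by blast
    let ?w = "\<lambda>S. v S - (of_bool (S = insert i T) - of_bool (S = T))"
    have w: "sum ?w \<A> = sum v \<A> - (of_bool (insert i T \<in> \<A>) - of_bool (T \<in> \<A>))" for \<A>
      by (simp add: sum_subtractf sum_of_bool_singleton)
    have contains: "superset_closed {T :: 'n set. j \<in> T}" for j
      by (auto simp: superset_closed_def)
    have "0 < sum v {T. i \<in> T}"
      using pos[OF contains] i by auto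
    then have iJ: "i \<in> J" using less.prems(3)[of i] by (auto simp: of_bool_def split: if_splits)
    have "card (J - {i}) < card J"
      using iJ by (intro psubset_card_mono) auto
    then have "\<exists>pa. (\<forall>k\<in>J - {i}. k \<notin> pa k) \<and>
        (\<forall>S. ?w S = (\<Sum>k\<in>J - {i}. of_bool (S = insert k (pa k)) - of_bool (S = pa k)))"
    proof (rule less.hyps)
      fix \<A> :: "'n set set" assume \<A>: "superset_closed \<A>"
      then show "0 \<le> sum ?w \<A>"
        unfolding w using nonneg[OF \<A>] pos[OF \<A>] by (cases "T \<in> \<A>") (auto simp: of_bool_def)
    next
      show "sum ?w UNIV = 0"
        unfolding w using less.prems(2) by simp
    next
      fix j show "sum ?w {T. j \<in> T} = of_bool (j \<in> J - {i})"
        unfolding w less.prems(3)[of j] using i iJ by (cases "j = i") simp_all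
    qed
    then obtain pa where pa: "\<forall>k\<in>J - {i}. k \<notin> pa k"
      "\<And>S. ?w S = (\<Sum>k\<in>J - {i}. of_bool (S = insert k (pa k)) - of_bool (S = pa k))"
      by blast
    have "v S = (\<Sum>k\<in>J. of_bool (S = insert k ((pa(i := T)) k)) - of_bool (S = (pa(i := T)) k))" for S
    proof -
      have "(\<Sum>k\<in>J - {i}. of_bool (S = insert k ((pa(i := T)) k)) - of_bool (S = (pa(i := T)) k)) = ?w S"
        unfolding pa(2) by (rule sum.cong) auto
      then show ?thesis
        using iJ by (simp add: sum.remove[of J i])
    qed
    moreover have "\<forall>k\<in>J. k \<notin> (pa(i := T)) k"
      using pa(1) i by auto
    ultimately show ?thesis by blast
  qed
qed

section \<open>Lattice points of the relaxation\<close>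

text \<open>
  The bounds on \<open>u\<close> are the nonnegativity of \<open>\<delta>\<^sub>N - \<delta>\<^sub>\<emptyset> - u\<close> on superset-closed classes without
  the empty set; a superset-closed class that contains the empty set is the whole power set, where
  the total mass is zero.
\<close>

lemma lattice_point_eq_standard_imset:
  fixes u :: "real ^ ('n::finite set)"
  assumes int: "lattice_point u"
    and total: "(\<Sum>T\<in>UNIV. u $ T) = 0"
    and single: "\<And>j. (\<Sum>T | j \<in> T. u $ T) = 0"
    and upper: "\<And>\<A>. \<A> \<noteq> {} \<Longrightarrow> {} \<notin> \<A> \<Longrightarrow> superset_closed \<A> \<Longrightarrow> (\<Sum>T\<in>\<A>. u $ T) \<le> 1"
  obtains G where "irrefl G" "u = standard_imset G"
proof -
  from int have "\<forall>T. \<exists>k. u $ T = of_int k"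
    unfolding lattice_point_def by (meson Ints_cases)
  then obtain k where k: "\<And>T. u $ T = of_int (k T)" by metis
  have sum_k: "(\<Sum>T\<in>A. u $ T) = of_int (sum k A)" for A
    by (simp add: k)
  let ?v = "\<lambda>T. of_bool (T = UNIV) - of_bool (T = {}) - k T"
  have v: "sum ?v A = of_bool (UNIV \<in> A) - of_bool ({} \<in> A) - sum k A" for A
    by (simp add: sum_subtractf sum_of_bool_singleton)
  have kU: "sum k UNIV = 0" using total by (simp only: sum_k of_int_eq_0_iff)
  have kj: "sum k {T. j \<in> T} = 0" for j using single[of j] by (simp only: sum_k of_int_eq_0_iff)
  have "0 \<le> sum ?v \<A>" if \<A>: "superset_closed \<A>" for \<A> :: "'n set set"
  proof -
    consider "\<A> = {}" | "{} \<in> \<A>" | "\<A> \<noteq> {}" "{} \<notin> \<A>" by blast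
    then show ?thesis
    proof cases
      case 1
      then show ?thesis by simp
    next
      case 2
      then have "\<A> = UNIV" using \<A> unfolding superset_closed_def by blast
      then show ?thesis unfolding v using kU by simp
    next
      case 3
      then have "UNIV \<in> \<A>" using \<A> unfolding superset_closed_def by blast
      moreover have "sum k \<A> \<le> 1"
        using upper[OF 3 \<A>] unfolding sum_k by linarith
      ultimately show ?thesis unfolding v using 3 by simp
    qed
  qed
  moreover have "sum ?v UNIV = 0" unfolding v using kU by simp
  moreover have "sum ?v {T. j \<in> T} = of_bool (j \<in> UNIV)" for j
    unfolding v using kj by simp
  ultimately obtain pa where pa: "\<And>i. i \<notin> pa i"
    "\<And>S. ?v S = (\<Sum>i\<in>UNIV. of_bool (S = insert i (pa i)) - of_bool (S = pa i))"
    using integral_flow_decomposition[of ?v UNIV] by blast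
  let ?G = "{(j, i). j \<in> pa i}"
  have par: "parents ?G i = pa i" for i by (auto simp: parents_def)
  have "u $ S = standard_imset ?G $ S" for S
  proof -
    have "standard_imset ?G $ S =
        of_bool (S = UNIV) - of_bool (S = {}) -
        (\<Sum>i\<in>UNIV. of_bool (S = insert i (pa i)) - of_bool (S = pa i))"
      using sum_standard_imset[of ?G "{S}"] by (simp add: par eq_commute)
    also have "\<dots> = of_int (of_bool (S = UNIV) - of_bool (S = {}) - ?v S)"
      unfolding pa(2) by simp
    also have "\<dots> = u $ S" by (simp add: k)
    finally show ?thesis by simp
  qed
  moreover have "irrefl ?G" using pa(1) by (auto simp: irrefl_def)
  ultimately show ?thesis using that by (auto simp: vec_eq_iff)
qed

lemma LP_relaxationI:
  assumes "polyhedron Q" "P \<subseteq> Q" "\<And>u. u \<in> Q \<Longrightarrow> lattice_point u \<Longrightarrow> u \<in> P"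
  shows "LP_relaxation Q P"
  using assms by (auto simp: LP_relaxation_def)

theorem corollary23:
  assumes "CARD('n::finite) \<ge> 2"
  shows "LP_relaxation
    {u :: real ^ ('n set).
      ((\<Sum>T\<in>UNIV. u $ T) = 0 \<and> (\<forall>j. (\<Sum>T | j \<in> T. u $ T) = 0)) \<and>
      (\<forall>\<A>. \<A> \<noteq> {} \<longrightarrow> {} \<notin> \<A> \<longrightarrow> superset_closed \<A> \<longrightarrow> (\<Sum>T\<in>\<A>. u $ T) \<le> 1) \<and>
      (\<forall>m\<in>extreme_supermodular. (\<Sum>T\<in>UNIV. m $ T * u $ T) \<ge> 0)}
    standard_imset_polytope"
    (is "LP_relaxation ?Q _")
proof -
  let ?a = "\<lambda>j. {u :: real ^ ('n set). (\<Sum>T | j \<in> T. u $ T) = 0}"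
  let ?b = "\<lambda>\<A>. {u :: real ^ ('n set). (\<Sum>T\<in>\<A>. u $ T) \<le> 1}"
  let ?c = "\<lambda>m. {u :: real ^ ('n set). (\<Sum>T\<in>UNIV. m $ T * u $ T) \<ge> 0}"
  have Q: "?Q = {u. (\<Sum>T\<in>UNIV. u $ T) = 0} \<inter> \<Inter>(range ?a) \<inter>
      \<Inter>(?b ` {\<A>. \<A> \<noteq> {} \<and> {} \<notin> \<A> \<and> superset_closed \<A>}) \<inter> \<Inter>(?c ` extreme_supermodular)"
    by blast
  have poly: "polyhedron ?Q"
    unfolding Q
    by (intro polyhedron_Int polyhedron_Inter polyhedron_sum_eq)
       (auto simp: finite_extreme_supermodular polyhedron_sum_eq polyhedron_sum_le
          polyhedron_sum_mult_ge)
  have mem: "standard_imset G \<in> ?Q" if "acyclic_digraph G" for G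
  proof -
    have "supermodular m" if "m \<in> extreme_supermodular" for m :: "real ^ ('n set)"
      using that face_of_imp_subset
      by (fastforce simp: extreme_supermodular_def extreme_ray_def standardized_supermodular_cone_def)
    moreover have "acyclic G" using that by (simp add: acyclic_digraph_def)
    ultimately show ?thesis
      using sum_standard_imset_UNIV sum_standard_imset_containing[OF that]
        sum_standard_imset_superset_closed_le sum_supermodular_mult_standard_imset_nonneg by blast
  qed
  have sub: "standard_imset_polytope \<subseteq> ?Q"
    unfolding standard_imset_polytope_def
  proof (rule hull_minimal)
    show "{standard_imset G | G. acyclic_digraph G} \<subseteq> ?Q"
    proof
      fix u :: "real ^ ('n set)" assume "u \<in> {standard_imset G | G. acyclic_digraph G}"
      then obtain G where "acyclic_digraph G" "u = standard_imset G" by blast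
      then show "u \<in> ?Q" using mem[of G] by (simp only:)
    qed
  qed (fact polyhedron_imp_convex[OF poly])
  have lattice: "u \<in> standard_imset_polytope" if u: "u \<in> ?Q" "lattice_point u" for u
  proof -
    obtain G where G: "irrefl G" "u = standard_imset G"
      by (rule lattice_point_eq_standard_imset[OF u(2)]) (use u(1) in simp_all)
    have "acyclic G"
      by (rule acyclic_if_standard_imset_nonneg[OF G(1)]) (use u(1) G(2) in simp)
    with G show ?thesis
      unfolding standard_imset_polytope_def acyclic_digraph_def by (auto intro!: hull_inc)
  qed
  show ?thesis
    using poly sub lattice by (rule LP_relaxationI)
qed

end
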